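(* For all $j,k\in\mathbb{N}$, $$\widehat{Ch}_j^{(k)}(x)=\sum_{n=0}^j\binom{j}{n}\frac{k!}{(k+n-j)!}\,Ch_n^{(k)}(x),$$ where terms with $k+n-j<0$ are interpreted as $0$.
   Context: For $k\in\mathbb{N}$, the Changhee polynomials of the first kind with order $k$, $Ch_n^{(k)}(x)$, and of the second kind with order $k$, $\widehat{Ch}_n^{(k)}(x)$, $n\ge0$, are defined by the generating functions (identities of formal power series in $t$, with $x$ an indeterminate) $$\sum_{n=0}^\infty Ch_n^{(k)}(x)\frac{t^n}{n!}=\left(\frac{2}{2+t}\right)^k(1+t)^x,\qquad \sum_{n=0}^\infty \widehat{Ch}_n^{(k)}(x)\frac{t^n}{n!}=\left(\frac{2}{2+t}\right)^k(1+t)^{x+k}.$$ Here $(1+t)^x=\sum_{j\ge0}\binom{x}{j}t^j$ with $\binom{x}{j}=\frac{x(x-1)\cdots(x-j+1)}{j!}$. The convention $1/m!=0$ for negative integers $m$ is used. $\mathbb{N}$ denotes the positive integers. *)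

theory Defs
  imports "HOL-Computational_Algebra.Computational_Algebra"
begin

text \<open>
  The indeterminate \<open>x\<close> is \<open>[:0, 1:]\<close> in \<open>'a poly\<close>, where \<open>'a\<close> is an arbitrary field of
  characteristic 0, and the generating functions are formal power series in \<open>t\<close> over \<open>'a poly\<close>.
\<close>

text \<open>
  The library's \<open>gchoose\<close> and \<open>fps_binomial\<close> are restricted to fields, so they do not apply to the
  indeterminate itself; see \<open>poly_poly_binomial\<close> below for the connection.
\<close>

definition poly_binomial :: "'a::field_char_0 poly \<Rightarrow> nat \<Rightarrow> 'a poly" where
  "poly_binomial p j = smult (1 / fact j) (\<Prod>i<j. p - of_nat i)"

definition one_plus_t_pow :: "'a::field_char_0 poly \<Rightarrow> 'a poly fps" where
  "one_plus_t_pow p = Abs_fps (poly_binomial p)"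

text \<open>
  The quotient of power series is formed over the field \<open>'a\<close>; its coefficients are then embedded
  as constant polynomials, since inversion is not available for power series over \<open>'a poly\<close>.
\<close>

definition changhee_factor :: "nat \<Rightarrow> 'a::field_char_0 poly fps" where
  "changhee_factor k = Abs_fps (\<lambda>n. [:fps_nth ((2 / (2 + fps_X)) ^ k) n:])"

definition changhee1 :: "nat \<Rightarrow> nat \<Rightarrow> 'a::field_char_0 poly" where
  "changhee1 k n = smult (fact n) (fps_nth (changhee_factor k * one_plus_t_pow [:0, 1:]) n)"

definition changhee2 :: "nat \<Rightarrow> nat \<Rightarrow> 'a::field_char_0 poly" where
  "changhee2 k n =
    smult (fact n) (fps_nth (changhee_factor k * one_plus_t_pow ([:0, 1:] + of_nat k)) n)"

definition inv_fact :: "int \<Rightarrow> 'a::field_char_0" where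
  "inv_fact m = (if m < 0 then 0 else 1 / fact (nat m))"

lemma poly_poly_binomial: "poly (poly_binomial p j) a = poly p a gchoose j"
  by (simp add: poly_binomial_def gbinomial_prod_rev poly_prod atLeast0LessThan)

lemma poly_one_plus_t_pow:
  "Abs_fps (\<lambda>j. poly (fps_nth (one_plus_t_pow p) j) a) = fps_binomial (poly p a)"
  by (simp add: fps_eq_iff one_plus_t_pow_def poly_poly_binomial)

lemma changhee1_genfun:
  "Abs_fps (\<lambda>n. smult (1 / fact n) (changhee1 k n)) = changhee_factor k * one_plus_t_pow [:0, 1:]"
  by (simp add: fps_eq_iff changhee1_def)

lemma changhee2_genfun:
  "Abs_fps (\<lambda>n. smult (1 / fact n) (changhee2 k n))
    = changhee_factor k * one_plus_t_pow ([:0, 1:] + of_nat k)"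
  by (simp add: fps_eq_iff changhee2_def)

lemma two_over_two_plus_t: "2 / (2 + fps_X) * (2 + fps_X) = (2 :: 'a::field_char_0 fps)"
proof -
  have "fps_nth (2 + fps_X :: 'a fps) 0 \<noteq> 0"
    by simp
  then show ?thesis
    by (simp add: fps_divide_unit mult.assoc inverse_mult_eq_1)
qed

end

theory Submission
  imports Defs
begin

text \<open>
  The two generating functions differ only by the factor \<open>(1 + t)\<^sup>k\<close>, because
  \<open>(1 + t)\<^bsup>x + k\<^esup> = (1 + t)\<^sup>x (1 + t)\<^sup>k\<close>
  (\<open>one_plus_t_pow_add\<close>, which is Vandermonde's convolution). Since \<open>k\<close> is a natural
  number, \<open>(1 + t)\<^sup>k\<close> has the integer coefficients \<open>k choose i\<close>
  (\<open>poly_binomial_of_nat\<close>). Comparing the coefficients of \<open>t\<^sup>j / j!\<close> therefore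
  expresses \<open>changhee2 k j\<close> as the sum over \<open>n \<le> j\<close> of
  \<open>j! / n! * (k choose (j - n))\<close> times \<open>changhee1 k n\<close>, and rearranging factorials turns
  this scalar into \<open>(j choose n) * k! / (k + n - j)!\<close> (\<open>binomial_scalar_eq\<close>).
\<close>

text \<open>
  Over an infinite field a polynomial is determined by its values, and each value of this identity
  is Vandermonde's convolution for generalized binomial coefficients in the field.
\<close>

lemma poly_binomial_Vandermonde:
  "poly_binomial (p + q) n = (\<Sum>i = 0..n. poly_binomial p i * poly_binomial q (n - i))"
proof -
  have "poly (poly_binomial (p + q) n) a
      = poly (\<Sum>i = 0..n. poly_binomial p i * poly_binomial q (n - i)) a" for a
    by (simp add: poly_sum poly_poly_binomial gbinomial_Vandermonde)
  then show ?thesis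
    by (simp add: poly_eq_poly_eq_iff [symmetric] fun_eq_iff)
qed

lemma one_plus_t_pow_add: "one_plus_t_pow (p + q) = one_plus_t_pow p * one_plus_t_pow q"
  by (simp add: fps_eq_iff fps_mult_nth one_plus_t_pow_def poly_binomial_Vandermonde)

lemma poly_binomial_of_nat: "poly_binomial (of_nat k) i = [:of_nat (k choose i):]"
proof -
  have "poly (poly_binomial (of_nat k) i) a = poly [:of_nat (k choose i):] a" for a :: 'a
    by (simp add: poly_poly_binomial binomial_gbinomial)
  then show ?thesis
    by (simp add: poly_eq_poly_eq_iff [symmetric] fun_eq_iff)
qed

text \<open>
  When \<open>k < j - n\<close> both sides vanish: the left one because \<open>k choose (j - n) = 0\<close>, the right one
  by the convention for reciprocal factorials of negative integers.
\<close>

lemma binomial_scalar_eq: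
  assumes "n \<le> j"
  shows "fact j / fact n * of_nat (k choose (j - n))
    = (of_nat (j choose n) * (fact k * inv_fact (int k + int n - int j)) :: 'a::field_char_0)"
proof (cases "j - n \<le> k")
  case True
  have "nat (int k + int n - int j) = k - (j - n)" and "\<not> int k + int n - int j < 0"
    using True assms by linarith+
  then show ?thesis
    using True assms by (simp add: inv_fact_def binomial_fact)
next
  case False
  then have "int k + int n - int j < 0"
    by linarith
  with False show ?thesis
    by (simp add: inv_fact_def)
qed

lemma poly_smult_sum: "smult c (sum f A) = (\<Sum>i\<in>A. smult c (f i))"
  by (simp add: poly_eq_iff coeff_sum sum_distrib_left)

theorem theorem3p2:
  fixes j k :: nat
  assumes "j \<ge> 1" and "k \<ge> 1"
  shows "(changhee2 k j :: 'a::field_char_0 poly)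
    = (\<Sum>n = 0..j. smult (of_nat (j choose n) * (fact k * inv_fact (int k + int n - int j)))
        (changhee1 k n))"
proof -
  let ?G = "changhee_factor k * one_plus_t_pow [:0, 1:] :: 'a poly fps"
  have "changhee2 k j = smult (fact j) (fps_nth (?G * one_plus_t_pow (of_nat k)) j)"
    by (simp only: changhee2_def one_plus_t_pow_add mult.assoc)
  also have "\<dots> = (\<Sum>n = 0..j. smult (fact j * of_nat (k choose (j - n))) (fps_nth ?G n))"
    unfolding fps_mult_nth [of ?G]
    by (simp add: one_plus_t_pow_def poly_binomial_of_nat poly_smult_sum)
  also have "\<dots> = (\<Sum>n = 0..j.
      smult (fact j / fact n * of_nat (k choose (j - n))) (changhee1 k n))"
    by (simp add: changhee1_def)
  also have "\<dots> = (\<Sum>n = 0..j.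
      smult (of_nat (j choose n) * (fact k * inv_fact (int k + int n - int j))) (changhee1 k n))"
    by (intro sum.cong refl) (simp only: binomial_scalar_eq atLeastAtMost_iff)
  finally show ?thesis .
qed

end
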